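(* Let $\lambda\ge 0$ and $a_\lambda>0$ be prespecified constants. If $D\sim\mathcal{N}(0,\mathbf{\Sigma})$ (conditionally on the fixed covariates $\mathbf{x}$) and $N_T=N_C$, then $$\mathrm{Cov}(D\mid \mathbf{x}, M_\lambda\le a_\lambda) = \mathbf{\Gamma}\,\mathbf{Diag}\big((\lambda_k d_{k,\lambda})_{1\le k\le K}\big)\,\mathbf{\Gamma}^\top,$$ where $\mathbf{\Gamma}$ is the orthogonal matrix of eigenvectors of $\mathbf{\Sigma}$ corresponding to the ordered eigenvalues $\lambda_1\ge\dots\ge\lambda_K>0$, and for all $k=1,\dots,K$, $$d_{k,\lambda} = \mathbb{E}\left[Z_k^2 \,\middle|\, \sum_{j=1}^K\frac{\lambda_j}{\lambda_j+\lambda}Z_j^2\le a_\lambda\right]$$ with $Z_1,\dots,Z_K$ i.i.d. $\mathcal{N}(0,1)$.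
   Context: $\mathbf{x}$ is a fixed real $N\times K$ covariate matrix on $N$ units, of which $N_T$ are assigned to treatment and $N_C=N-N_T$ to control ($N_T,N_C\ge1$). $\mathbf{\Sigma} = \frac{N}{N_T N_C} S^2_{\mathbf{x}}$ is assumed positive definite, where $S^2_{\mathbf{x}} = (N-1)^{-1}(\mathbf{x}-\mathbf{1}_N\bar{\mathbf{x}}_N)^\top(\mathbf{x}-\mathbf{1}_N\bar{\mathbf{x}}_N)$ and $\bar{\mathbf{x}}_N = N^{-1}\mathbf{1}_N^\top\mathbf{x}$ ($\mathbf{1}_N$ is the all-ones column vector). Spectral decomposition: $\mathbf{\Sigma}=\mathbf{\Gamma}\,\mathbf{Diag}(\lambda_1,\dots,\lambda_K)\,\mathbf{\Gamma}^\top$, where $\mathbf{Diag}(\cdot)$ is the diagonal matrix with the given diagonal. $D$ is a random vector in $\mathbb{R}^K$ representing the covariate mean difference $\bar{\mathbf{x}}_T-\bar{\mathbf{x}}_C$ between treatment and control; the Normality assumption is an idealization imposed on its law. The ridge Mahalanobis distance is $M_\lambda = D^\top(\mathbf{\Sigma}+\lambda\mathbf{I}_K)^{-1}D$. $\mathrm{Cov}(\cdot\mid\mathbf{x},M_\lambda\le a_\lambda)$ is the covariance matrix under the law conditioned on the event $\{M_\lambda\le a_\lambda\}$. *)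

theory Defs
  imports "HOL-Probability.Probability"
begin

section \<open>Matrices\<close>

definition Diag :: "real^'k \<Rightarrow> real^'k^'k" where
  "Diag d = (\<chi> i j. if i = j then d $ i else 0)"

definition pos_def :: "real^'k^'k \<Rightarrow> bool" where
  "pos_def A \<longleftrightarrow> transpose A = A \<and> (\<forall>v. v \<noteq> 0 \<longrightarrow> v \<bullet> (A *v v) > 0)"

text \<open>The labels \<open>1, \<dots>, K\<close> are the elements of the finite linearly ordered index type
  \<open>'k\<close>, so that the eigenvalues are listed in decreasing order along \<open>'k\<close>.\<close>

definition ordered_spectral_decomposition ::
    "((real, 'k) vec, 'k) vec \<Rightarrow> ((real, 'k) vec, 'k) vec \<Rightarrow> (real, 'k::{finite,linorder}) vec \<Rightarrow> bool" where
  "ordered_spectral_decomposition A \<Gamma> lam \<longleftrightarrow>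
     orthogonal_matrix \<Gamma> \<and>
     A = \<Gamma> ** Diag lam ** transpose \<Gamma> \<and>
     (\<forall>i j. i \<le> j \<longrightarrow> lam $ j \<le> lam $ i)"

section \<open>Covariates\<close>

text \<open>A covariate matrix \<open>x :: real^'k^'n\<close> has one row for each unit and one column for each
  covariate, so \<open>N = CARD('n)\<close> and \<open>K = CARD('k)\<close>.\<close>

definition covariate_mean :: "real^'k^'n \<Rightarrow> real^'k" where
  "covariate_mean x = (1 / real CARD('n)) *\<^sub>R ((\<chi> i. 1) v* x)"

definition centered :: "real^'k^'n \<Rightarrow> real^'k^'n" where
  "centered x = (\<chi> i. x $ i - covariate_mean x)"

definition sample_cov :: "real^'k^'n \<Rightarrow> real^'k^'k" where
  "sample_cov x = (1 / (real CARD('n) - 1)) *\<^sub>R (transpose (centered x) ** centered x)"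

definition Sigma_x :: "nat \<Rightarrow> nat \<Rightarrow> real^'k^'n \<Rightarrow> real^'k^'k" where
  "Sigma_x NT NC x = (real CARD('n) / (real NT * real NC)) *\<^sub>R sample_cov x"

definition ridge_mahalanobis :: "real^'k^'k \<Rightarrow> real \<Rightarrow> real^'k \<Rightarrow> real" where
  "ridge_mahalanobis S l v = v \<bullet> (matrix_inv (S + l *\<^sub>R mat 1) *v v)"

section \<open>Random vectors\<close>

text \<open>Density of the nondegenerate multivariate normal law; \<open>S\<close> is meant to be positive
  definite.\<close>

definition mvn_density :: "real^'k \<Rightarrow> real^'k^'k \<Rightarrow> real^'k \<Rightarrow> real" where
  "mvn_density \<mu> S v =
     exp (- ((v - \<mu>) \<bullet> (matrix_inv S *v (v - \<mu>))) / 2) / sqrt ((2 * pi) ^ CARD('k) * det S)"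

definition cov_matrix :: "'a measure \<Rightarrow> ('a \<Rightarrow> real^'k) \<Rightarrow> real^'k^'k" where
  "cov_matrix M X = (\<chi> i j.
     \<integral>\<omega>. (X \<omega> $ i - (\<integral>\<omega>'. X \<omega>' $ i \<partial>M)) * (X \<omega> $ j - (\<integral>\<omega>'. X \<omega>' $ j \<partial>M)) \<partial>M)"

text \<open>Conditioning a probability measure on the event that \<open>P\<close> holds, \<open>B \<mapsto> Pr(B \<inter> E) / Pr(E)\<close>;
  it is meant for events of positive probability.\<close>

definition conditioned :: "'a measure \<Rightarrow> ('a \<Rightarrow> bool) \<Rightarrow> 'a measure" where
  "conditioned M P = uniform_measure M {\<omega> \<in> space M. P \<omega>}"

end

theory Submission
  imports Defs
begin

text \<open>Write \<open>D = \<Gamma> \<Lambda>\<^bsup>1/2\<^esup> z\<close> in law, where \<open>z\<close> is a standard normal vector. In these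
  coordinates the ridge Mahalanobis distance becomes \<open>\<Sum>\<^sub>j \<lambda>\<^sub>j / (\<lambda>\<^sub>j + \<lambda>) z\<^sub>j\<^sup>2\<close>, so the conditioning event
  is invariant under flipping the sign of any coordinate, as is the law of \<open>z\<close>. Hence the
  conditional means and the off-diagonal conditional second moments of \<open>z\<close> vanish, and the diagonal
  ones are the \<open>d\<^sub>k\<close>. Second moments are integrable because each \<open>z\<^sub>k\<close> is bounded on the event.\<close>

section \<open>Invariance of Lebesgue measure under orthogonal maps\<close>

lemma borel_measurable_orthogonal_transformation:
  fixes T :: "'a::euclidean_space \<Rightarrow> 'a"
  assumes "orthogonal_transformation T"
  shows "T \<in> borel \<rightarrow>\<^sub>M borel"
  using assms by (intro borel_measurable_continuous_onI linear_continuous_on)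
    (simp add: orthogonal_transformation_linear linear_linear)

text \<open>The change of variables theorems of the library need a well-ordered index type, so this is
  proved from the translation invariance of Lebesgue measure: computing the convolution of the
  image measure with the indicator of a ball in two ways gives the image measure up to a factor,
  which is 1 because \<open>T\<close> maps balls to balls.\<close>

lemma distr_lborel_orthogonal:
  fixes T :: "'a::euclidean_space \<Rightarrow> 'a"
  assumes T: "orthogonal_transformation T"
  shows "distr lborel borel T = lborel"
proof (rule measure_eqI)
  fix A assume "A \<in> sets (distr lborel borel T)"
  then have A [measurable]: "A \<in> sets borel"
    by simp
  define U where "U = inv T"
  have TU: "T (U y) = y" for y
    unfolding U_def using T by (simp add: orthogonal_transformation_surj surj_f_inv_f)
  have add: "T (x + y) = T x + T y" and diff: "T (x - y) = T x - T y" for x y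
    using T by (simp_all add: linear_add linear_diff orthogonal_transformation_linear)
  note [measurable] = borel_measurable_orthogonal_transformation[OF T]
  define B :: "'a set" where "B = ball 0 1"
  have [measurable]: "B \<in> sets borel"
    by (simp add: B_def)
  define b where "b = emeasure lborel B"
  have b: "b \<noteq> 0" "b \<noteq> \<infinity>"
    using unit_ball_vol_pos[of "real DIM('a)"] by (auto simp: b_def B_def emeasure_ball simp del: unit_ball_vol_pos)
  have shift: "(\<integral>\<^sup>+x. f (x + c) \<partial>lborel) = (\<integral>\<^sup>+x. f x \<partial>lborel)"
    if [measurable]: "f \<in> borel_measurable borel" for f and c :: 'a
    by (subst (2) lborel_distr_plus[of c, symmetric]) (simp add: nn_integral_distr add.commute)
  \<comment> \<open>\<open>T\<close> is an isometry, so the points \<open>x\<close> with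
    \<open>T x\<close> in the unit ball around \<open>y\<close> form the unit ball around
    \<open>U y\<close>.\<close>
  have ball: "(\<integral>\<^sup>+x. indicator B (y - T x) \<partial>lborel) = b" for y
  proof -
    have "indicator B (y - T x) = (indicator (ball (U y) 1) x :: ennreal)" for x
    proof -
      have "norm (y - T x) = norm (U y - x)"
        using orthogonal_transformation_norm[OF T, of "U y - x"] by (simp add: diff TU)
      then show ?thesis
        by (simp add: B_def indicator_def dist_norm norm_minus_commute)
    qed
    then show ?thesis
      by (simp add: b_def B_def emeasure_ball)
  qed
  have "emeasure (distr lborel borel T) A * b
      = (\<integral>\<^sup>+y. (\<integral>\<^sup>+x. indicator A (T x) \<partial>lborel) * indicator B y \<partial>lborel)"
  proof -
    have "emeasure (distr lborel borel T) A = (\<integral>\<^sup>+x. indicator A (T x) \<partial>lborel)"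
      by (subst nn_integral_indicator[symmetric]) (simp_all add: nn_integral_distr del: nn_integral_indicator)
    then show ?thesis
      by (simp add: b_def nn_integral_cmult)
  qed
  \<comment> \<open>For fixed \<open>y\<close>, translating \<open>x\<close> by \<open>U y\<close>
    replaces \<open>T x\<close> by \<open>T x + y\<close>. After Fubini, \<open>y\<close> is
    translated by \<open>- T x\<close> instead, which frees \<open>A\<close> from
    \<open>T\<close>.\<close>
  also have "\<dots> = (\<integral>\<^sup>+y. (\<integral>\<^sup>+x. indicator A (T x + y) * indicator B y \<partial>lborel) \<partial>lborel)"
    using shift[of "\<lambda>x. indicator A (T x)" "U _"] by (simp add: add TU nn_integral_multc)
  also have "\<dots> = (\<integral>\<^sup>+x. (\<integral>\<^sup>+y. indicator A (T x + y) * indicator B y \<partial>lborel) \<partial>lborel)"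
    by (rule lborel_pair.Fubini') measurable
  also have "\<dots> = (\<integral>\<^sup>+x. (\<integral>\<^sup>+y. indicator A y * indicator B (y - T x) \<partial>lborel) \<partial>lborel)"
  proof (rule nn_integral_cong)
    show "(\<integral>\<^sup>+y. indicator A (T x + y) * indicator B y \<partial>lborel)
        = (\<integral>\<^sup>+y. indicator A y * indicator B (y - T x) \<partial>lborel)" for x
      using shift[of "\<lambda>y. indicator A (T x + y) * indicator B y" "- T x"] by simp
  qed
  also have "\<dots> = (\<integral>\<^sup>+y. (\<integral>\<^sup>+x. indicator A y * indicator B (y - T x) \<partial>lborel) \<partial>lborel)"
    by (rule lborel_pair.Fubini') measurable
  also have "\<dots> = emeasure lborel A * b"
    by (simp add: nn_integral_cmult nn_integral_multc ball)
  finally show "emeasure (distr lborel borel T) A = emeasure lborel A"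
    using b by (simp add: ennreal_mult_cancel_left mult.commute[of _ b])
qed simp

section \<open>Lebesgue measure on vectors as a product measure, and products of densities\<close>

lemma prod_Basis_vec: "(\<Prod>b\<in>(Basis :: (real^'k) set). f b) = (\<Prod>k\<in>UNIV. f (axis k 1))"
  by (simp add: Basis_vec_def UNION_singleton_eq_range prod.reindex axis_eq_axis inj_on_def)

lemma borel_measurable_vec_lambda:
  fixes f :: "'k::finite \<Rightarrow> 'a \<Rightarrow> real"
  assumes "\<And>k. f k \<in> borel_measurable M"
  shows "(\<lambda>x. \<chi> k. f k x) \<in> borel_measurable M"
  using assms by (subst borel_measurable_euclidean_space) (auto simp: Basis_vec_def inner_axis)

text \<open>Links \<open>real^'k\<close> to the function space on which independence is phrased.
  Lebesgue measure is determined by its values on boxes, and the preimage of a box under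
  \<open>vec_lambda\<close> is a product of intervals.\<close>

lemma lborel_vec_eq: "(lborel :: (real^'k) measure) = distr (\<Pi>\<^sub>M k\<in>UNIV. lborel) borel vec_lambda"
proof (rule lborel_eqI)
  interpret product_sigma_finite "\<lambda>_::'k. lborel :: real measure" ..
  have [measurable]: "vec_lambda \<in> (\<Pi>\<^sub>M k\<in>UNIV. lborel) \<rightarrow>\<^sub>M (borel :: (real^'k) measure)"
    by (rule borel_measurable_vec_lambda) simp
  fix l u :: "real^'k" assume le: "\<And>b. b \<in> Basis \<Longrightarrow> l \<bullet> b \<le> u \<bullet> b"
  then have le': "l $ k \<le> u $ k" for k
    using le[of "axis k 1"] by (simp add: axis_in_Basis_iff inner_axis)
  have "emeasure (distr (\<Pi>\<^sub>M k\<in>UNIV. lborel) borel vec_lambda) (box l u)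
     = emeasure (\<Pi>\<^sub>M k\<in>UNIV. lborel) (\<Pi>\<^sub>E k\<in>UNIV. {l $ k <..< u $ k})"
    by (subst emeasure_distr) (auto intro!: arg_cong2[where f=emeasure] simp: mem_box_cart space_PiM PiE_iff)
  also have "\<dots> = (\<Prod>k\<in>UNIV. ennreal (u $ k - l $ k))"
    using le' by (subst emeasure_PiM) auto
  also have "\<dots> = (\<Prod>k\<in>UNIV. (u - l) $ k)"
    using le' by (simp add: prod_ennreal)
  also have "(\<Prod>k\<in>UNIV. (u - l) $ k) = (\<Prod>b\<in>Basis. (u - l) \<bullet> b)"
    by (simp add: prod_Basis_vec inner_axis)
  finally show "emeasure (distr (\<Pi>\<^sub>M k\<in>UNIV. lborel) borel vec_lambda) (box l u) = (\<Prod>b\<in>Basis. (u - l) \<bullet> b)" .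
qed simp

text \<open>A product measure with sigma-finite factors is determined by its values on rectangles,
  and there the integral of a product of one-variable functions factorizes.\<close>

lemma PiM_density_lborel:
  fixes g :: "'i \<Rightarrow> 'a::euclidean_space \<Rightarrow> ennreal"
  assumes "finite I" and [measurable]: "\<And>i. g i \<in> borel_measurable borel"
    and "\<And>i. sigma_finite_measure (density lborel (g i))"
  shows "(\<Pi>\<^sub>M i\<in>I. density lborel (g i)) = density (\<Pi>\<^sub>M i\<in>I. lborel) (\<lambda>x. \<Prod>i\<in>I. g i (x i))"
proof -
  interpret L: product_sigma_finite "\<lambda>_::'i. lborel :: 'a measure" ..
  interpret G: product_sigma_finite "\<lambda>i. density lborel (g i)"
    using assms(3) by (simp add: product_sigma_finite_def)
  have "density (\<Pi>\<^sub>M i\<in>I. lborel) (\<lambda>x. \<Prod>i\<in>I. g i (x i)) = (\<Pi>\<^sub>M i\<in>I. density lborel (g i))"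
  proof (rule G.PiM_eqI[OF assms(1)])
    show "sets (density (\<Pi>\<^sub>M i\<in>I. lborel) (\<lambda>x. \<Prod>i\<in>I. g i (x i))) = sets (\<Pi>\<^sub>M i\<in>I. density lborel (g i))"
      by (simp cong: sets_PiM_cong)
    fix A assume "\<And>i. i \<in> I \<Longrightarrow> A i \<in> sets (density lborel (g i))"
    then have [measurable]: "\<And>i. i \<in> I \<Longrightarrow> A i \<in> sets borel"
      by simp
    have "emeasure (density (\<Pi>\<^sub>M i\<in>I. lborel) (\<lambda>x. \<Prod>i\<in>I. g i (x i))) (Pi\<^sub>E I A)
        = (\<integral>\<^sup>+x. (\<Prod>i\<in>I. g i (x i)) * indicator (Pi\<^sub>E I A) x \<partial>(\<Pi>\<^sub>M i\<in>I. lborel))"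
      using assms(1) by (intro emeasure_density) (auto intro!: sets_PiM_I_finite)
    also have "\<dots> = (\<integral>\<^sup>+x. (\<Prod>i\<in>I. g i (x i) * indicator (A i) (x i)) \<partial>(\<Pi>\<^sub>M i\<in>I. lborel))"
      using assms(1) by (intro nn_integral_cong)
        (auto simp: prod.distrib space_PiM PiE_iff indicator_def prod_zero_iff extensional_def prod_eq_1_iff)
    also have "\<dots> = (\<Prod>i\<in>I. \<integral>\<^sup>+x. g i x * indicator (A i) x \<partial>lborel)"
      using assms(1) by (intro L.product_nn_integral_prod) auto
    also have "\<dots> = (\<Prod>i\<in>I. emeasure (density lborel (g i)) (A i))"
      by (intro prod.cong) (auto simp: emeasure_density)
    finally show "emeasure (density (\<Pi>\<^sub>M i\<in>I. lborel) (\<lambda>x. \<Prod>i\<in>I. g i (x i))) (Pi\<^sub>E I A)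
        = (\<Prod>i\<in>I. emeasure (density lborel (g i)) (A i))" .
  qed
  then show ?thesis ..
qed

section \<open>Conditional expectations and odd integrands\<close>

text \<open>If the event has probability 0, both sides are 0.\<close>

lemma integral_conditioned:
  fixes f :: "_ \<Rightarrow> real"
  assumes "finite_measure M" and [measurable]: "X \<in> M \<rightarrow>\<^sub>M N" "Measurable.pred N Q"
    and [measurable]: "f \<in> borel_measurable N"
  shows "(\<integral>\<omega>. f (X \<omega>) \<partial>conditioned M (\<lambda>\<omega>. Q (X \<omega>)))
    = (\<integral>y. of_bool (Q y) * f y \<partial>distr M N X) / measure (distr M N X) {y \<in> space N. Q y}"
proof -
  interpret finite_measure M by fact
  define E where "E = {\<omega> \<in> space M. Q (X \<omega>)}"
  have [measurable]: "E \<in> sets M"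
    by (simp add: E_def)
  \<comment> \<open>\<open>integral_density\<close> needs a real-valued density. If \<open>E\<close>
    is null, the \<open>ennreal\<close> quotient is infinite on \<open>E\<close> while the real one
    is 0, so the agreement is only almost everywhere.\<close>
  have "AE \<omega> in M. indicator E \<omega> / emeasure M E = ennreal (indicator E \<omega> / measure M E)"
  proof (cases "measure M E = 0")
    case True
    then have "AE \<omega> in M. \<omega> \<notin> E"
      by (auto simp: emeasure_eq_measure intro!: AE_not_in)
    then show ?thesis
      by eventually_elim simp
  next
    case False
    then have "measure M E > 0"
      by (simp add: zero_less_measure_iff)
    then show ?thesis
      by (auto simp: emeasure_eq_measure divide_ennreal[symmetric] indicator_def)
  qed
  then have "conditioned M (\<lambda>\<omega>. Q (X \<omega>)) = density M (\<lambda>\<omega>. ennreal (indicator E \<omega> / measure M E))"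
    unfolding conditioned_def uniform_measure_def E_def[symmetric] by (intro density_cong) auto
  then have "(\<integral>\<omega>. f (X \<omega>) \<partial>conditioned M (\<lambda>\<omega>. Q (X \<omega>)))
      = (\<integral>\<omega>. (of_bool (Q (X \<omega>)) * f (X \<omega>)) / measure M E \<partial>M)"
    by (auto simp: integral_density E_def intro!: Bochner_Integration.integral_cong)
  also have "\<dots> = (\<integral>y. of_bool (Q y) * f y \<partial>distr M N X) / measure M E"
    by (simp add: integral_distr)
  also have "measure M E = measure (distr M N X) {y \<in> space N. Q y}"
    by (subst measure_distr) (auto simp: E_def intro!: arg_cong[where f="measure M"] dest: measurable_space[OF assms(2)])
  finally show ?thesis .
qed

text \<open>Changing variables by \<open>R\<close> shows that the integral equals its own negative.
  This includes non-integrable \<open>f\<close>, whose Bochner integral is 0 by convention.\<close>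

lemma integral_eq_0_of_odd:
  fixes f :: "'a \<Rightarrow> real"
  assumes "distr M M R = M" and [measurable]: "R \<in> M \<rightarrow>\<^sub>M M" "f \<in> borel_measurable M"
    and "\<And>x. f (R x) = - f x"
  shows "integral\<^sup>L M f = 0"
proof -
  have "integral\<^sup>L M f = integral\<^sup>L (distr M M R) f"
    by (simp add: assms(1))
  also have "\<dots> = - integral\<^sup>L M f"
    by (simp add: integral_distr assms(4))
  finally show ?thesis
    by simp
qed


section \<open>The standard normal law on \<open>real^'k\<close>\<close>

definition std_mvn :: "(real^'k) measure" where
  "std_mvn = density lborel (\<lambda>z. ennreal (\<Prod>k\<in>UNIV. std_normal_density (z $ k)))"

lemma sets_std_mvn [simp, measurable_cong]: "sets std_mvn = sets borel"
  by (simp add: std_mvn_def)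

lemma space_std_mvn [simp]: "space std_mvn = UNIV"
  by (simp add: std_mvn_def)

text \<open>Independence makes the joint law the product of the marginals. Its product density is
  then carried along \<open>vec_lambda\<close>, under which the product of Lebesgue measures becomes
  \<open>lborel\<close>.\<close>

lemma distr_indep_std_normal:
  fixes Z :: "'k::finite \<Rightarrow> 'b \<Rightarrow> real"
  assumes "prob_space P" "prob_space.indep_vars P (\<lambda>_. borel) Z UNIV"
    and Z: "\<And>k. distributed P lborel (Z k) std_normal_density"
  shows "distr P borel (\<lambda>\<omega>. \<chi> k. Z k \<omega>) = std_mvn"
proof -
  interpret P: prob_space P by fact
  have [measurable]: "Z k \<in> borel_measurable P" for k
    using distributed_measurable[OF Z] by simp
  have [measurable]: "(\<lambda>\<omega>. \<lambda>k\<in>UNIV. Z k \<omega>) \<in> P \<rightarrow>\<^sub>M (\<Pi>\<^sub>M k\<in>UNIV. borel)"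
    by (rule measurable_restrict) simp
  have vec [measurable]: "vec_lambda \<in> (\<Pi>\<^sub>M k\<in>UNIV. borel) \<rightarrow>\<^sub>M (borel :: (real^'k) measure)"
    by (rule borel_measurable_vec_lambda) simp
  have [measurable]: "vec_lambda \<in> (\<Pi>\<^sub>M k\<in>UNIV. lborel) \<rightarrow>\<^sub>M (borel :: (real^'k) measure)"
    using vec by (simp cong: measurable_cong_sets sets_PiM_cong)
  have "distr P borel (\<lambda>\<omega>. \<chi> k. Z k \<omega>)
      = distr (distr P (\<Pi>\<^sub>M k\<in>UNIV. borel) (\<lambda>\<omega>. \<lambda>k\<in>UNIV. Z k \<omega>)) borel vec_lambda"
    by (subst distr_distr, simp_all) (simp add: comp_def restrict_def)
  also have "distr P (\<Pi>\<^sub>M k\<in>UNIV. borel) (\<lambda>\<omega>. \<lambda>k\<in>UNIV. Z k \<omega>) = (\<Pi>\<^sub>M k\<in>UNIV. distr P borel (Z k))"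
    using assms(2) by (subst (asm) P.indep_vars_iff_distr_eq_PiM) auto
  also have "(\<lambda>k. distr P borel (Z k)) = (\<lambda>_. density lborel std_normal_density)"
    using distributed_distr_eq_density[OF Z] by (simp cong: distr_cong)
  also have "(\<Pi>\<^sub>M k\<in>(UNIV :: 'k set). density lborel std_normal_density)
      = density (\<Pi>\<^sub>M k\<in>UNIV. lborel) (\<lambda>x. \<Prod>k\<in>UNIV. ennreal (std_normal_density (x k)))"
    by (rule PiM_density_lborel)
      (auto intro!: prob_space_imp_sigma_finite prob_space_normal_density)
  also have "distr \<dots> borel vec_lambda = std_mvn"
    by (subst std_mvn_def, subst lborel_vec_eq, subst density_distr) (simp_all add: prod_ennreal)
  finally show ?thesis .
qed

text \<open>Exhibits the joint density as a function of \<open>z \<bullet> z\<close> alone, as used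
  for rotation invariance and for the comparison with \<open>mvn_density\<close>.\<close>

lemma prod_std_normal_density:
  "(\<Prod>k\<in>UNIV. std_normal_density (z $ k)) = exp (- (z \<bullet> z) / 2) / sqrt (2 * pi) ^ CARD('k)" for z :: "real^'k"
  unfolding std_normal_density_def
  by (simp add: prod.distrib prod_dividef exp_sum[symmetric] inner_vec_def power2_eq_square
      sum_divide_distrib sum_negf)

text \<open>An orthogonal map preserves both \<open>lborel\<close> and the norm, and the density
  depends only on the norm.\<close>

lemma distr_std_mvn_orthogonal:
  fixes R :: "real^'k \<Rightarrow> real^'k"
  assumes R: "orthogonal_transformation R"
  shows "distr std_mvn std_mvn R = std_mvn"
proof -
  note [measurable] = borel_measurable_orthogonal_transformation[OF R]
  have "distr std_mvn std_mvn R = distr (density lborel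
      (\<lambda>z. ennreal (\<Prod>k\<in>UNIV. std_normal_density (R z $ k)))) borel R"
    using R by (simp add: std_mvn_def prod_std_normal_density orthogonal_transformation_def cong: distr_cong)
  also have "\<dots> = density (distr lborel borel R) (\<lambda>z. ennreal (\<Prod>k\<in>UNIV. std_normal_density (z $ k)))"
    by (subst density_distr) simp_all
  finally show ?thesis
    by (simp add: distr_lborel_orthogonal[OF R] std_mvn_def)
qed

section \<open>Spectral calculus and the multivariate normal density\<close>

lemma Diag_mult_vec: "Diag c *v w = (\<chi> k. c $ k * w $ k)"
  by (simp add: Diag_def matrix_vector_mult_def if_distrib[of "\<lambda>x. x * _"] cong: if_cong)

lemma spectral_entry: "(G ** Diag c ** transpose G) $ i $ j = (\<Sum>k\<in>UNIV. G $ i $ k * c $ k * G $ j $ k)"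
  by (simp add: matrix_matrix_mult_def Diag_def transpose_def if_distrib[of "\<lambda>x. _ * x"] cong: if_cong)

lemma det_spectral:
  assumes "orthogonal_matrix G"
  shows "det (G ** Diag c ** transpose G) = (\<Prod>k\<in>UNIV. c $ k)"
proof -
  have "det (Diag c) = (\<Prod>k\<in>UNIV. c $ k)"
    by (subst det_diagonal) (auto simp: Diag_def)
  then show ?thesis
    using det_orthogonal_matrix[OF assms] by (auto simp: det_mul det_transpose)
qed

text \<open>In eigenvector coordinates the inverse divides by the eigenvalues; this is checked by
  multiplying back.\<close>

lemma matrix_inv_spectral:
  assumes G: "orthogonal_matrix G" and c: "\<And>k. c $ k \<noteq> 0"
  shows "matrix_inv (G ** Diag c ** transpose G) *v (G *v y) = G *v (\<chi> k. y $ k / c $ k)"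
proof -
  let ?S = "G ** Diag c ** transpose G"
  have "invertible ?S"
    using c by (simp add: invertible_det_nz det_spectral[OF G])
  \<comment> \<open>\<open>matrix_inv\<close> is a Hilbert choice, so its defining property has to
    be drawn from invertibility.\<close>
  then have inv: "matrix_inv ?S ** ?S = mat 1"
    unfolding matrix_inv_def invertible_def by (rule someI2_ex) blast
  have "?S *v (G *v (\<chi> k. y $ k / c $ k)) = G *v (Diag c *v ((transpose G ** G) *v (\<chi> k. y $ k / c $ k)))"
    by (simp add: matrix_vector_mul_assoc matrix_mul_assoc)
  also have "\<dots> = G *v y"
    using G c by (simp add: orthogonal_matrix Diag_mult_vec)
  finally show ?thesis
    by (metis inv matrix_vector_mul_assoc matrix_vector_mul_lid)
qed

lemma borel_measurable_matrix_vector_mult [measurable]: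
  "(\<lambda>v. A *v v) \<in> borel \<rightarrow>\<^sub>M borel" for A :: "real^'n^'m"
  by (intro borel_measurable_continuous_onI linear_continuous_on) (simp add: linear_linear)

lemma quadratic_form_spectral:
  assumes G: "orthogonal_matrix G" and c: "\<And>k. c $ k \<noteq> 0"
  shows "(G *v y) \<bullet> (matrix_inv (G ** Diag c ** transpose G) *v (G *v y)) = (\<Sum>k\<in>UNIV. (y $ k)\<^sup>2 / c $ k)"
proof -
  have "(G *v y) \<bullet> (G *v w) = y \<bullet> w" for w
    using G orthogonal_transformation_matrix[of "(*v) G"] by (simp add: orthogonal_transformation_def)
  then show ?thesis
    by (simp add: matrix_inv_spectral[OF G c] inner_vec_def power2_eq_square)
qed

text \<open>Since \<open>G ** transpose G = mat 1\<close>, the ridge term shifts every eigenvalue by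
  \<open>l\<close> and keeps the eigenvectors.\<close>

lemma ridge_mahalanobis_spectral:
  assumes G: "orthogonal_matrix G" and c: "\<And>k. c $ k + l \<noteq> 0"
  shows "ridge_mahalanobis (G ** Diag c ** transpose G) l (G *v y) = (\<Sum>k\<in>UNIV. (y $ k)\<^sup>2 / (c $ k + l))"
proof -
  have "mat 1 $ i $ j = (\<Sum>k\<in>UNIV. G $ i $ k * G $ j $ k)" for i j
    using G by (simp add: orthogonal_matrix_def vec_eq_iff matrix_matrix_mult_def transpose_def)
  then have "G ** Diag c ** transpose G + l *\<^sub>R mat 1 = G ** Diag (\<chi> k. c $ k + l) ** transpose G"
    by (simp add: vec_eq_iff spectral_entry sum_distrib_left sum.distrib[symmetric] algebra_simps)
  then show ?thesis
    using quadratic_form_spectral[OF G, of "\<chi> k. c $ k + l" y] c by (simp add: ridge_mahalanobis_def)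
qed

text \<open>The map is a coordinate scaling followed by an orthogonal map. The latter preserves
  \<open>lborel\<close>, and the former contributes the Jacobian \<open>?s\<close>.\<close>

lemma density_mvn_eq_distr_std_mvn:
  fixes G :: "real^'k^'k"
  assumes G: "orthogonal_matrix G" and c: "\<And>k. c $ k > 0"
  shows "density lborel (\<lambda>v. ennreal (mvn_density 0 (G ** Diag c ** transpose G) v))
    = distr std_mvn borel (\<lambda>z. G *v (\<chi> k. sqrt (c $ k) * z $ k))" (is "density lborel (\<lambda>v. ennreal (?g v)) = _")
proof (rule measure_eqI)
  let ?T = "\<lambda>z. (\<chi> k. sqrt (c $ k) * z $ k) :: real^'k" and ?s = "\<Prod>k\<in>UNIV. sqrt (c $ k)"
  have T [measurable]: "?T \<in> borel \<rightarrow>\<^sub>M borel"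
    using borel_measurable_matrix_vector_mult[of "Diag (\<chi> k. sqrt (c $ k))"] by (simp add: Diag_mult_vec)
  have [measurable]: "?g \<in> borel_measurable borel"
    unfolding mvn_density_def by measurable
  have s: "?s \<ge> 0"
    using c by (intro prod_nonneg) (simp add: less_imp_le)
  have scale: "lborel = density (distr lborel borel ?T) (\<lambda>_. ennreal ?s)"
  proof -
    \<comment> \<open>\<open>lborel_affine_euclidean\<close> takes its scaling factors per basis
      vector; \<open>axis_index\<close> recovers the coordinate.\<close>
    let ?c = "\<lambda>b :: real^'k. sqrt (c $ axis_index b)"
    have "0 + (\<Sum>j\<in>Basis. (?c j * (z \<bullet> j)) *\<^sub>R j) = ?T z" for z
      using vec_lambda_eq_sum[of "\<lambda>k x. sqrt (c $ k) * x" z] by simp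
    moreover have "(\<Prod>j\<in>Basis. \<bar>?c j\<bar>) = ?s"
      using c by (simp add: prod_Basis_vec less_imp_le)
    moreover have "?c j \<noteq> 0" for j
      using c[of "axis_index j"] by simp
    ultimately show ?thesis
      using lborel_affine_euclidean[of ?c 0] by simp
  qed
  \<comment> \<open>The Jacobian \<open>?s\<close> cancels the square root of the determinant in the
    normalizing constant, and the quadratic form collapses to \<open>z \<bullet> z\<close>.\<close>
  have dens: "?s * ?g (G *v ?T z) = (\<Prod>k\<in>UNIV. std_normal_density (z $ k))" for z
  proof -
    have "(G *v ?T z) \<bullet> (matrix_inv (G ** Diag c ** transpose G) *v (G *v ?T z)) = z \<bullet> z"
    proof (subst quadratic_form_spectral[OF G])
      show "c $ k \<noteq> 0" for k
        using c[of k] by simp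
      have "(sqrt (c $ k) * z $ k)\<^sup>2 / c $ k = z $ k * z $ k" for k
        using c[of k] by (simp add: power_mult_distrib power2_eq_square[of "z $ k"])
      then show "(\<Sum>k\<in>UNIV. (?T z $ k)\<^sup>2 / c $ k) = z \<bullet> z"
        by (simp add: inner_vec_def)
    qed
    moreover have "sqrt (\<Prod>k\<in>K. c $ k) = (\<Prod>k\<in>K. sqrt (c $ k))" for K
      by (induction K rule: infinite_finite_induct) (simp_all add: real_sqrt_mult)
    then have "sqrt ((2 * pi) ^ CARD('k) * (\<Prod>k\<in>UNIV. c $ k)) = sqrt (2 * pi) ^ CARD('k) * ?s"
      by (simp add: real_sqrt_mult real_sqrt_power power_mult_distrib)
    moreover have "c $ k \<noteq> 0" for k
      using c[of k] by simp
    moreover have "?s > 0"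
      using c by (intro prod_pos) simp
    ultimately show ?thesis
      by (simp add: mvn_density_def det_spectral[OF G] prod_std_normal_density)
  qed
  fix A assume "A \<in> sets (density lborel (\<lambda>v. ennreal (?g v)))"
  then have [measurable]: "A \<in> sets borel"
    by simp
  have "emeasure (density lborel (\<lambda>v. ennreal (?g v))) A
      = (\<integral>\<^sup>+v. ennreal (?g v) * indicator A v \<partial>distr lborel borel ((*v) G))"
    using G by (subst distr_lborel_orthogonal)
      (auto simp: emeasure_density orthogonal_transformation_matrix)
  also have "\<dots> = (\<integral>\<^sup>+w. ennreal (?g (G *v w)) * indicator A (G *v w) \<partial>density (distr lborel borel ?T) (\<lambda>_. ennreal ?s))"
    by (subst scale[symmetric]) (simp add: nn_integral_distr)
  also have "\<dots> = (\<integral>\<^sup>+z. ennreal (?s * ?g (G *v ?T z)) * indicator A (G *v ?T z) \<partial>lborel)"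
    using s by (simp add: nn_integral_density nn_integral_distr ennreal_mult' mult.assoc)
  also have "\<dots> = emeasure (distr std_mvn borel (\<lambda>z. G *v ?T z)) A"
    by (simp only: dens) (simp add: std_mvn_def emeasure_distr emeasure_density vimage_def indicator_def of_bool_def)
  finally show "emeasure (density lborel (\<lambda>v. ennreal (?g v))) A = emeasure (distr std_mvn borel (\<lambda>z. G *v ?T z)) A" .
qed simp


section \<open>The conditional covariance matrix\<close>

lemma cov_matrix_conditioned_normal:
  fixes lam :: "real^'k" and \<Gamma> \<Sigma> :: "real^'k^'k"
  assumes \<Gamma>: "orthogonal_matrix \<Gamma>" and \<Sigma>: "\<Sigma> = \<Gamma> ** Diag lam ** transpose \<Gamma>"
    and lam: "\<And>k. lam $ k > 0" and l: "l \<ge> 0"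
    and "prob_space M" and D: "distributed M lborel D (mvn_density 0 \<Sigma>)"
    and "prob_space P" and indep: "prob_space.indep_vars P (\<lambda>_. borel) Z UNIV"
    and Z: "\<And>k. distributed P lborel (Z k) std_normal_density"
  shows "cov_matrix (conditioned M (\<lambda>\<omega>. ridge_mahalanobis \<Sigma> l (D \<omega>) \<le> a)) D
    = \<Gamma> ** Diag (\<chi> k. lam $ k * (\<integral>\<omega>. (Z k \<omega>)\<^sup>2
        \<partial>conditioned P (\<lambda>\<omega>. (\<Sum>j\<in>UNIV. lam $ j / (lam $ j + l) * (Z j \<omega>)\<^sup>2) \<le> a))) ** transpose \<Gamma>"
proof -
  interpret M: prob_space M by fact
  interpret P: prob_space P by fact
  define T :: "real^'k \<Rightarrow> real^'k" where "T z = \<Gamma> *v (\<chi> k. sqrt (lam $ k) * z $ k)" for z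
  define Q where "Q z \<longleftrightarrow> (\<Sum>j\<in>UNIV. lam $ j / (lam $ j + l) * (z $ j)\<^sup>2) \<le> a" for z :: "real^'k"
  \<comment> \<open>\<open>I f / p\<close> is the conditional expectation of \<open>f\<close> given
    \<open>Q\<close>. Both sides of the claim are written with the same \<open>p\<close>, so only
    identities between values of \<open>I\<close> remain.\<close>
  define I :: "(real^'k \<Rightarrow> real) \<Rightarrow> real" where "I f = (\<integral>z. of_bool (Q z) * f z \<partial>std_mvn)" for f
  define p where "p = measure std_mvn {z :: real^'k. Q z}"

  have T_nth: "T z $ i = (\<Sum>k\<in>UNIV. \<Gamma> $ i $ k * sqrt (lam $ k) * z $ k)" for z i
    by (simp add: T_def matrix_vector_mult_def mult.assoc)
  have [measurable]: "T \<in> borel \<rightarrow>\<^sub>M borel"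
    using borel_measurable_matrix_vector_mult[of "\<Gamma> ** Diag (\<chi> k. sqrt (lam $ k))"]
    by (simp add: T_def[abs_def] matrix_vector_mul_assoc[symmetric] Diag_mult_vec)
  have Q_meas [measurable]: "Measurable.pred borel Q"
    unfolding Q_def by measurable
  have D_meas [measurable]: "D \<in> M \<rightarrow>\<^sub>M borel"
    using distributed_measurable[OF D] by simp
  have D_distr: "distr M borel D = distr std_mvn borel T"
    using distributed_distr_eq_density[OF D] density_mvn_eq_distr_std_mvn[OF \<Gamma> lam]
    by (simp add: \<Sigma> T_def[abs_def] cong: distr_cong)
  have Z_distr: "distr P borel (\<lambda>\<omega>. \<chi> k. Z k \<omega>) = std_mvn"
    by (rule distr_indep_std_normal[OF \<open>prob_space P\<close> indep Z])
  have [measurable]: "Z k \<in> borel_measurable P" for k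
    using distributed_measurable[OF Z] by simp
  have Zvec [measurable]: "(\<lambda>\<omega>. \<chi> k. Z k \<omega>) \<in> P \<rightarrow>\<^sub>M borel"
    by (rule borel_measurable_vec_lambda) simp
  \<comment> \<open>Total mass 1 is inherited from the law of the vector of the \<open>Z k\<close>;
    the bounded integrands below are integrable because of it.\<close>
  interpret std_mvn: prob_space "std_mvn :: (real^'k) measure"
    unfolding Z_distr[symmetric] by (rule P.prob_space_distr) simp

  have Q_ridge: "ridge_mahalanobis \<Sigma> l (T z) \<le> a \<longleftrightarrow> Q z" for z
  proof -
    have "lam $ k + l \<noteq> 0" for k
      using lam[of k] l by linarith
    then show ?thesis
      using lam by (simp add: \<Sigma> T_def ridge_mahalanobis_spectral[OF \<Gamma>] Q_def power_mult_distrib less_imp_le)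
  qed
  have ridge_meas [measurable]: "Measurable.pred borel (\<lambda>v. ridge_mahalanobis \<Sigma> l v \<le> a)"
    unfolding ridge_mahalanobis_def by measurable
  have E_D: "(\<integral>\<omega>. f (D \<omega>) \<partial>conditioned M (\<lambda>\<omega>. ridge_mahalanobis \<Sigma> l (D \<omega>) \<le> a)) = I (\<lambda>z. f (T z)) / p"
    if [measurable]: "f \<in> borel_measurable borel" for f
  proof -
    have "measure (distr std_mvn borel T) {v. ridge_mahalanobis \<Sigma> l v \<le> a} = p"
      by (subst measure_distr) (simp_all add: p_def vimage_def Q_ridge)
    then show ?thesis
      using integral_conditioned[OF M.finite_measure_axioms D_meas ridge_meas, of f]
      by (simp add: D_distr integral_distr Q_ridge I_def)
  qed
  have E_Z: "(\<integral>\<omega>. (Z k \<omega>)\<^sup>2 \<partial>conditioned P (\<lambda>\<omega>. (\<Sum>j\<in>UNIV. lam $ j / (lam $ j + l) * (Z j \<omega>)\<^sup>2) \<le> a))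
      = I (\<lambda>z. (z $ k)\<^sup>2) / p" for k
    using integral_conditioned[OF P.finite_measure_axioms Zvec Q_meas, of "\<lambda>z. (z $ k)\<^sup>2"]
    by (simp add: Z_distr I_def p_def Q_def)

  \<comment> \<open>The symmetry must preserve the event as well as the law, so that the truncated
    integrand is still odd.\<close>
  have odd: "I f = 0" if [measurable]: "f \<in> borel_measurable borel" and R: "orthogonal_transformation R"
    and QR: "\<And>z. Q (R z) = Q z" and fR: "\<And>z. f (R z) = - f z" for f R
    unfolding I_def
  proof (rule integral_eq_0_of_odd[OF distr_std_mvn_orthogonal[OF R]])
    show "R \<in> std_mvn \<rightarrow>\<^sub>M std_mvn"
      using borel_measurable_orthogonal_transformation[OF R] by (simp cong: measurable_cong_sets)
  qed (auto simp: QR fR)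
  \<comment> \<open>All signs are flipped at once: \<open>T\<close> is linear and \<open>Q\<close>
    involves only squares.\<close>
  have mean: "I (\<lambda>z. T z $ i) = 0" for i
    by (rule odd[of _ uminus])
      (auto simp: Q_def T_nth sum_negf orthogonal_transformation_neg[where f="\<lambda>x. x", simplified])
  \<comment> \<open>Only coordinate \<open>k\<close> is flipped, so the product with a different
    coordinate changes sign.\<close>
  have cross: "I (\<lambda>z. z $ k * z $ m) = 0" if "k \<noteq> m" for k m
  proof (rule odd[of _ "\<lambda>z. \<chi> j. if j = k then - z $ j else z $ j"])
    show "orthogonal_transformation (\<lambda>z. (\<chi> j. if j = k then - z $ j else z $ j) :: real^'k)"
      by (auto simp: orthogonal_transformation_def linear_iff vec_eq_iff inner_vec_def intro!: sum.cong)
    show "Q (\<chi> j. if j = k then - z $ j else z $ j) = Q z" for z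
      unfolding Q_def by (intro arg_cong[where f="\<lambda>s. s \<le> a"] sum.cong) auto
  qed (use that in auto)
  \<comment> \<open>Needed to move the integral inside the double sum in the expansion of
    \<open>T z $ i * T z $ j\<close>.\<close>
  have integrable: "integrable std_mvn (\<lambda>z. of_bool (Q z) * (z $ k * z $ m))" for k m
  proof (rule std_mvn.integrable_const_bound)
    have bound: "(z $ j)\<^sup>2 \<le> a * (lam $ j + l) / lam $ j" if "Q z" for z j
    proof -
      \<comment> \<open>One summand is at most the whole sum of nonnegative terms; solving for the
        square uses \<open>lam $ j > 0\<close>.\<close>
      have "lam $ j / (lam $ j + l) * (z $ j)\<^sup>2 \<le> (\<Sum>j\<in>UNIV. lam $ j / (lam $ j + l) * (z $ j)\<^sup>2)"
        using lam l by (intro member_le_sum) (auto simp: add_pos_nonneg less_imp_le)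
      also have "\<dots> \<le> a"
        using that by (simp add: Q_def)
      finally show ?thesis
        using lam[of j] l by (simp add: field_simps add_pos_nonneg)
    qed
    \<comment> \<open>The sum of the two coordinate bounds suffices because
      \<open>\<bar>u * v\<bar> \<le> u * u + v * v\<close>. The absolute values keep
      \<open>?B\<close> nonnegative, which covers the points outside \<open>Q\<close>.\<close>
    let ?B = "\<bar>a * (lam $ k + l) / lam $ k\<bar> + \<bar>a * (lam $ m + l) / lam $ m\<bar>"
    have "norm (of_bool (Q z) * (z $ k * z $ m)) \<le> ?B" for z
    proof (cases "Q z")
      case True
      have "\<bar>z $ k * z $ m\<bar> \<le> (z $ k)\<^sup>2 + (z $ m)\<^sup>2"
        using sum_squares_bound[of "\<bar>z $ k\<bar>" "\<bar>z $ m\<bar>"] abs_ge_zero[of "z $ k * z $ m"]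
        unfolding abs_mult power2_abs by linarith
      then show ?thesis
        using bound[OF True, of k] bound[OF True, of m] True by (simp del: abs_divide)
    qed simp
    then show "AE z in std_mvn. norm (of_bool (Q z) * (z $ k * z $ m)) \<le> ?B"
      by simp
  qed measurable

  have "I (\<lambda>z. T z $ i * T z $ j) = (\<Sum>k\<in>UNIV. \<Gamma> $ i $ k * (lam $ k * I (\<lambda>z. (z $ k)\<^sup>2)) * \<Gamma> $ j $ k)" for i j
  proof -
    have "of_bool (Q z) * (T z $ i * T z $ j) = (\<Sum>k\<in>UNIV. \<Sum>m\<in>UNIV.
        (\<Gamma> $ i $ k * sqrt (lam $ k) * (\<Gamma> $ j $ m * sqrt (lam $ m))) * (of_bool (Q z) * (z $ k * z $ m)))" for z
      unfolding T_nth sum_product by (simp add: sum_distrib_left mult_ac)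
    then have "I (\<lambda>z. T z $ i * T z $ j) = (\<Sum>k\<in>UNIV. \<Sum>m\<in>UNIV.
        (\<Gamma> $ i $ k * sqrt (lam $ k) * (\<Gamma> $ j $ m * sqrt (lam $ m))) * I (\<lambda>z. z $ k * z $ m))"
      by (simp add: I_def integrable)
    also have "\<dots> = (\<Sum>k\<in>UNIV. (\<Gamma> $ i $ k * sqrt (lam $ k) * (\<Gamma> $ j $ k * sqrt (lam $ k))) * I (\<lambda>z. z $ k * z $ k))"
    proof (intro sum.cong refl)
      fix k
      let ?h = "\<lambda>m. (\<Gamma> $ i $ k * sqrt (lam $ k) * (\<Gamma> $ j $ m * sqrt (lam $ m))) * I (\<lambda>z. z $ k * z $ m)"
      show "(\<Sum>m\<in>UNIV. ?h m) = ?h k"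
        by (subst sum.remove[of UNIV k]) (auto intro!: sum.neutral simp: cross)
    qed
    also have "\<dots> = (\<Sum>k\<in>UNIV. \<Gamma> $ i $ k * (lam $ k * I (\<lambda>z. (z $ k)\<^sup>2)) * \<Gamma> $ j $ k)"
    proof (intro sum.cong refl)
      fix k
      have "sqrt (lam $ k) * (sqrt (lam $ k) * y) = lam $ k * y" for y
        using lam[of k] by (simp add: mult.assoc[symmetric])
      then show "\<Gamma> $ i $ k * sqrt (lam $ k) * (\<Gamma> $ j $ k * sqrt (lam $ k)) * I (\<lambda>z. z $ k * z $ k)
          = \<Gamma> $ i $ k * (lam $ k * I (\<lambda>z. (z $ k)\<^sup>2)) * \<Gamma> $ j $ k"
        by (simp add: power2_eq_square mult_ac)
    qed
    finally show ?thesis .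
  qed
  moreover have "(\<integral>\<omega>. D \<omega> $ i \<partial>conditioned M (\<lambda>\<omega>. ridge_mahalanobis \<Sigma> l (D \<omega>) \<le> a)) = 0" for i
    using E_D[of "\<lambda>v. v $ i"] by (simp add: mean)
  moreover have "(\<integral>\<omega>. D \<omega> $ i * D \<omega> $ j \<partial>conditioned M (\<lambda>\<omega>. ridge_mahalanobis \<Sigma> l (D \<omega>) \<le> a))
      = I (\<lambda>z. T z $ i * T z $ j) / p" for i j
    using E_D[of "\<lambda>v. v $ i * v $ j"] by simp
  \<comment> \<open>As the conditional means vanish, the covariances are plain second moments, and
    \<open>spectral_entry\<close> matches them with the right-hand side entry by entry.\<close>
  ultimately show ?thesis
    unfolding E_Z by (simp add: cov_matrix_def vec_eq_iff spectral_entry sum_divide_distrib)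
qed

theorem theorem4p2:
  fixes x :: "((real, 'k::{finite,linorder}) vec, 'n::finite) vec"
    and NT NC :: nat
    and \<Sigma> \<Gamma> :: "((real, 'k) vec, 'k) vec"
    and lam d :: "(real, 'k) vec"
    and l a :: real
    and M :: "'a measure" and D :: "'a \<Rightarrow> (real, 'k) vec"
    and P :: "'b measure" and Z :: "'k \<Rightarrow> 'b \<Rightarrow> real"
  assumes "NT \<ge> 1" "NC \<ge> 1" "NT + NC = CARD('n)"
    and "NT = NC"
    and Sigma: "\<Sigma> = Sigma_x NT NC x"
    and "pos_def \<Sigma>"
    and "ordered_spectral_decomposition \<Sigma> \<Gamma> lam" "\<forall>k. lam $ k > 0"
    and "l \<ge> 0" "a > 0"
    and "prob_space M" "distributed M lborel D (mvn_density 0 \<Sigma>)"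
    and "prob_space P" "prob_space.indep_vars P (\<lambda>_. borel) Z UNIV"
      "\<forall>k. distributed P lborel (Z k) std_normal_density"
    and d: "\<forall>k. d $ k = (\<integral>\<omega>. (Z k \<omega>)\<^sup>2
              \<partial>conditioned P (\<lambda>\<omega>. (\<Sum>j\<in>UNIV. lam $ j / (lam $ j + l) * (Z j \<omega>)\<^sup>2) \<le> a))"
  shows "cov_matrix (conditioned M (\<lambda>\<omega>. ridge_mahalanobis \<Sigma> l (D \<omega>) \<le> a)) D =
         \<Gamma> ** Diag (\<chi> k. lam $ k * d $ k) ** transpose \<Gamma>"
proof -
  have "orthogonal_matrix \<Gamma>" "\<Sigma> = \<Gamma> ** Diag lam ** transpose \<Gamma>"
    using assms(7) by (simp_all add: ordered_spectral_decomposition_def)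
  then show ?thesis
    using assms cov_matrix_conditioned_normal[of \<Gamma> \<Sigma> lam l M D P Z a] by simp
qed

end
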